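(* Let $a,b\in\mathbb{Z}$, and let $\mathcal{Q}_{a,b,d}(n)$ be the quantization function and $\mathrm{Vol}(\mathcal{H}^d_{a,b,n})$ the symplectic volume of the generalized Hirzebruch fibration over $\mathbb{CP}^d$ with twisting parameter $n$. In the large-twisting limit, the ratio between quantization function and symplectic volume satisfies $$\lim_{n\to\infty}\frac{\mathcal{Q}_{a,b,d}(n)}{\mathrm{Vol}(\mathcal{H}^d_{a,b,n})}=\sum_{k=0}^{d}\binom{d+1}{k}B_k\,b^{-k},$$ where $B_k$ are the Bernoulli numbers (with $B_1=-\tfrac12$). In particular, $\mathcal{Q}_{a,b,d}(n)\sim\mathrm{Vol}(\mathcal{H}^d_{a,b,n})$ up to a constant that is a polynomial of degree $d+1$ in $1/b$ and independent of $a$.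
   Context: For $n\in\mathbb{N}\cup\{0\}$ and $a,b\in\mathbb{Z}$, the generalized Hirzebruch fibration $\mathcal{H}^d_{a,b,n}$ is the manifold $\mathrm{Proj}(\mathcal{O}\oplus\mathcal{O}(-n))\to\mathbb{CP}^d$, embedded in $\mathbb{CP}^d\times\mathbb{CP}^{d+1}$ by $([x_0:\dots:x_d],[z_0:z_1])\mapsto([x_0:\dots:x_d],[z_0:z_1x_0^n:\dots:z_1x_d^n])$ and equipped with the restriction of $a\,\omega_{FS}$ on $\mathbb{CP}^d$ plus $b\,\omega_{FS}$ on $\mathbb{CP}^{d+1}$, where $\omega_{FS}=i\partial\bar\partial\log\sum_i|w_i|^2$ in homogeneous coordinates $[w_0:\dots:w_N]$. Its moment polytope is taken to be $$\Delta^d_{a,b,n}=\Big\{(x_1,\dots,x_{d+1})\in\mathbb{R}^{d+1}\ \Big|\ x_i\ge 0,\ \sum_{i=1}^d x_i\le a+n(b-x_{d+1}),\ x_{d+1}\le b\Big\}.$$ The quantization function is the dimension of the geometric quantization, given by $\mathcal{Q}_{a,b,d}(n)=\#(\Delta^d_{a,b,n}\cap\mathbb{Z}^{d+1})=\sum_{i=0}^{b}\binom{a+d+ni}{d}$. The symplectic volume is the Euclidean volume of the moment polytope, $$\mathrm{Vol}(\mathcal{H}^d_{a,b,n})=\mathrm{Vol}(\Delta^d_{a,b,n})=\frac{1}{(d+1)!\,n}\Big((a+nb)^{d+1}-a^{d+1}\Big).$$ The Bernoulli numbers with $B_1=-\tfrac12$ are defined by $\frac{t}{e^{t}-1}=\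sum_{k\ge0}B_k\frac{t^k}{k!}$.
   Formalization: The printed limit fails (d=1, a=0, b=1: limit 2, sum 0); B_k is replaced by (-1)^k B_k, i.e. B_1 = +1/2 in the sum. The polynomial has degree at most d+1 (the sum stops at k=d). It is assumed that d ≥ 1 and b ≥ 1, since the claim fails for d=0 and the volume is zero for b ≤ 0. *)

theory Defs
  imports "HOL-Analysis.Analysis" "HOL-Library.Landau_Symbols"
begin

text \<open>
  Points of \<open>\<real>\<^sup>d\<^sup>+\<^sup>1\<close> are functions on the index set \<open>{1..d+1}\<close>, extended by \<^const>\<open>undefined\<close>
  outside of it, so that they form the space of the product measure
  \<open>\<Pi>\<^sub>M i\<in>{1..d+1}. lborel\<close>, which is the Lebesgue measure on Borel sets.
\<close>

definition hirzebruch_polytope :: "nat \<Rightarrow> int \<Rightarrow> int \<Rightarrow> nat \<Rightarrow> (nat \<Rightarrow> real) set" where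
  "hirzebruch_polytope d a b n =
     {x \<in> {1..d+1} \<rightarrow>\<^sub>E UNIV.
        (\<forall>i\<in>{1..d+1}. 0 \<le> x i) \<and>
        (\<Sum>i=1..d. x i) \<le> real_of_int a + real n * (real_of_int b - x (d+1)) \<and>
        x (d+1) \<le> real_of_int b}"

text \<open>
  For \<open>a \<ge> 0\<close> and \<open>b \<ge> 0\<close> the number of lattice points is
  \<open>\<Sum>i=0..b. (a + d + n i choose d)\<close>; for \<open>a > 0\<close>, \<open>b > 0\<close> it is the dimension of the
  geometric quantization of the generalized Hirzebruch fibration.
\<close>

definition hirzebruch_quantization :: "nat \<Rightarrow> int \<Rightarrow> int \<Rightarrow> nat \<Rightarrow> nat" where
  "hirzebruch_quantization d a b n =
     card (hirzebruch_polytope d a b n \<inter> ({1..d+1} \<rightarrow>\<^sub>E \<int>))"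

definition hirzebruch_volume :: "nat \<Rightarrow> int \<Rightarrow> int \<Rightarrow> nat \<Rightarrow> real" where
  "hirzebruch_volume d a b n =
     measure (\<Pi>\<^sub>M i\<in>{1..d+1}. lborel) (hirzebruch_polytope d a b n)"

text \<open>
  The Bernoulli numbers with \<open>B\<^sub>1 = -1/2\<close>, from \<open>t / (e\<^sup>t - 1) = \<Sum>k. B\<^sub>k t\<^sup>k / k!\<close>. Division of
  power series cancels the common factor \<open>t\<close>. Passing from \<open>B\<^sub>k\<close> to \<open>(-1)\<^sup>k B\<^sub>k\<close> changes
  \<open>B\<^sub>1\<close> to \<open>1/2\<close> and leaves all other Bernoulli numbers unchanged. Faulhaber's formula
  for \<open>\<Sum>i<b. i\<^sup>d\<close> uses \<open>B\<^sub>k\<close>, while the one for \<open>\<Sum>i\<le>b. i\<^sup>d\<close>, which is the leading behaviour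
  of the number of lattice points, uses \<open>(-1)\<^sup>k B\<^sub>k\<close>.
\<close>

definition bernoulli :: "nat \<Rightarrow> real" where
  "bernoulli k = fact k * fps_nth (fps_X / (fps_exp 1 - 1)) k"

lemma bernoulli_generating_function:
  "Abs_fps (\<lambda>k. bernoulli k / fact k) * (fps_exp 1 - 1) = fps_X"
proof -
  have sub: "subdegree (fps_exp (1::real) - 1) = 1"
    by (rule subdegreeI) auto
  then have "fps_exp (1::real) - 1 \<noteq> 0"
    by (metis subdegree_0 zero_neq_one)
  then have "(fps_exp (1::real) - 1) dvd fps_X"
    by (subst fps_dvd_iff) (simp_all only: sub subdegree_fps_X fps_X_neq_zero order.refl not_False_eq_True)
  moreover have "Abs_fps (\<lambda>k. bernoulli k / fact k) = fps_X / (fps_exp 1 - 1)"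
    by (simp add: bernoulli_def fps_eq_iff)
  ultimately show ?thesis
    by simp
qed

lemma bernoulli_0: "bernoulli 0 = 1"
  using arg_cong[OF bernoulli_generating_function, of "\<lambda>f. fps_nth f 1"]
  by (simp add: fps_mult_nth)

lemma bernoulli_1: "bernoulli 1 = - 1 / 2"
  using arg_cong[OF bernoulli_generating_function, of "\<lambda>f. fps_nth f 2"] bernoulli_0
  by (simp add: fps_mult_nth numeral_2_eq_2)

end

theory Submission
  imports Defs
begin

text \<open>
  Slice the polytope by the last coordinate. The slice at the integer height \<open>b - i\<close> is a \<open>d\<close>-dimensional
  simplex of size \<open>a + n i\<close>, so it has about \<open>(n i)\<^sup>d / d!\<close> lattice points, and both the number of
  lattice points and the volume of the polytope grow like \<open>n\<^sup>d\<close>. The limits of the quotients by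
  \<open>n\<^sup>d\<close> are \<open>(\<Sum>i\<le>b. i\<^sup>d) / d!\<close> and \<open>b\<^sup>d\<^sup>+\<^sup>1 / (d+1)!\<close>, and Faulhaber's formula expresses the quotient
  of the two by Bernoulli numbers.
\<close>

section \<open>Bernoulli numbers and Faulhaber's formula\<close>

text \<open>Replacing X by -X in the generating function produces the signs (-1)^k and the factor
  e^(-X) - 1. Multiplication by e^X turns this factor into -(e^X - 1).\<close>

lemma bernoulli_generating_function_neg:
  "Abs_fps (\<lambda>k. (-1) ^ k * bernoulli k / fact k) * (fps_exp 1 - 1) = fps_X * fps_exp 1"
proof -
  let ?X = "fps_const (-1::real) * fps_X"
  let ?G = "Abs_fps (\<lambda>k. (-1) ^ k * bernoulli k / fact k)"
  have "(fps_exp 1 - 1) oo ?X = fps_exp (-1) - (1 :: real fps)"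
    using fps_exp_compose_linear[of 1 "-1 :: real"]
    by (simp add: fps_compose_sub_distrib del: fps_const_neg fps_exp_compose_linear)
  moreover have "Abs_fps (\<lambda>k. bernoulli k / fact k) oo ?X = ?G"
    by (simp add: fps_compose_linear del: fps_const_neg)
  ultimately have "?G * (fps_exp (-1) - 1) = (Abs_fps (\<lambda>k. bernoulli k / fact k) * (fps_exp 1 - 1)) oo ?X"
    by (subst fps_compose_mult_distrib) simp_all
  also have "\<dots> = - fps_X"
    by (simp add: bernoulli_generating_function fps_const_neg[symmetric] del: fps_const_neg)
  finally have "?G * (fps_exp (-1) - 1) * fps_exp 1 = - fps_X * fps_exp 1"
    by simp
  moreover have "(fps_exp (-1) - 1) * fps_exp 1 = - (fps_exp 1 - 1 :: real fps)"
    using fps_exp_add_mult[of "-1::real" 1] by (simp add: algebra_simps)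
  ultimately show ?thesis
    by (simp only: mult.assoc mult_minus_left mult_minus_right neg_equal_iff_equal)
qed

text \<open>Faulhaber's formula, obtained from the coefficient of X^(d+1) in X e^X / (e^X - 1) *
  (e^(mX) - 1). A geometric sum cancels e^X - 1, and the remaining factor e^X shifts the range of
  summation from 0..m-1 to 1..m.\<close>

lemma sum_power_eq_bernoulli:
  "real (d + 1) * (\<Sum>i=1..m. real i ^ d) =
     (\<Sum>k=0..d. real ((d + 1) choose k) * ((-1) ^ k * bernoulli k) * real m ^ (d + 1 - k))"
proof -
  let ?G = "Abs_fps (\<lambda>k. (-1) ^ k * bernoulli k / fact k)"
  have geom: "fps_exp (real m) - 1 = (fps_exp 1 - 1) * (\<Sum>i<m. fps_exp (real i))"
    using power_diff_1_eq[of "fps_exp (1::real)" m] by (simp add: fps_exp_power_mult)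
  have "?G * (fps_exp (real m) - 1) = fps_X * (fps_exp 1 * (\<Sum>i<m. fps_exp (real i)))"
    unfolding geom mult.assoc[symmetric] bernoulli_generating_function_neg ..
  also have "fps_exp 1 * (\<Sum>i<m. fps_exp (real i)) = (\<Sum>i=1..m. fps_exp (real i))"
    by (simp add: sum_distrib_left fps_exp_add_mult[symmetric] sum.atLeast1_atMost_eq add.commute)
  finally have "fps_nth (?G * (fps_exp (real m) - 1)) (d + 1) = (\<Sum>i=1..m. real i ^ d) / fact d"
    by (simp add: fps_sum_nth sum_divide_distrib)
  \<comment> \<open>The index k = d + 1 drops out because e^(mX) - 1 has no constant term.\<close>
  moreover have "fps_nth (?G * (fps_exp (real m) - 1)) (d + 1) =
      (\<Sum>k=0..d. (-1) ^ k * bernoulli k / fact k * (real m ^ (d + 1 - k) / fact (d + 1 - k)))"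
    unfolding fps_mult_nth Suc_eq_plus1[symmetric] sum.atLeast0_atMost_Suc
    by (auto intro!: sum.cong)
  ultimately have "(\<Sum>i=1..m. real i ^ d) = fact d *
      (\<Sum>k=0..d. (-1) ^ k * bernoulli k / fact k * (real m ^ (d + 1 - k) / fact (d + 1 - k)))"
    by (metis fact_nonzero nonzero_mult_div_cancel_left times_divide_eq_right)
  then have "real (d + 1) * (\<Sum>i=1..m. real i ^ d) = fact (d + 1) *
      (\<Sum>k=0..d. (-1) ^ k * bernoulli k / fact k * (real m ^ (d + 1 - k) / fact (d + 1 - k)))"
    by (simp only: fact_Suc Suc_eq_plus1[symmetric] mult_ac)
  also have "\<dots> = (\<Sum>k=0..d. real ((d + 1) choose k) * ((-1) ^ k * bernoulli k) * real m ^ (d + 1 - k))"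
    unfolding sum_distrib_left
    by (intro sum.cong refl) (simp add: binomial_fact)
  finally show ?thesis .
qed

section \<open>Lattice points of simplices\<close>

text \<open>An arbitrary index set allows induction on it. The size may be negative, as happens to
  the slice sizes \<open>a + n * i\<close> when \<open>a\<close> is negative.\<close>

definition lattice_simplex :: "'a set \<Rightarrow> real \<Rightarrow> ('a \<Rightarrow> real) set" where
  "lattice_simplex A t = {x \<in> A \<rightarrow>\<^sub>E \<int>. (\<forall>i\<in>A. 0 \<le> x i) \<and> sum x A \<le> t}"

lemma lattice_simplex_neg: "t < 0 \<Longrightarrow> lattice_simplex A t = {}"
  using sum_nonneg[of A] by (fastforce simp: lattice_simplex_def)

text \<open>A lattice point is a height \<open>j\<close> together with a point of the slice
  \<open>F j\<close>. This serves both the induction on the dimension of a simplex and the slicing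
  of the polytope.\<close>

lemma card_sliced_lattice:
  fixes F :: "nat \<Rightarrow> ('a \<Rightarrow> real) set"
  assumes "b \<notin> A" "finite J" and fin: "\<And>j. j \<in> J \<Longrightarrow> finite (F j)"
    and F: "\<And>j. j \<in> J \<Longrightarrow> F j \<subseteq> A \<rightarrow>\<^sub>E \<int>"
    and S: "\<And>x. x \<in> S \<longleftrightarrow> x \<in> insert b A \<rightarrow>\<^sub>E \<int> \<and> (\<exists>j\<in>J. x b = real j \<and> restrict x A \<in> F j)"
  shows "finite S" "card S = (\<Sum>j\<in>J. card (F j))"
proof -
  have bij: "bij_betw (\<lambda>(j, x). x(b := real j)) (Sigma J F) S"
  \<comment> \<open>The height \<open>x b\<close> is a real number of the form
    \<open>real j\<close>, from which the floor recovers \<open>j\<close>. Restriction to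
    \<open>A\<close> resets the entry at \<open>b\<close> to \<open>undefined\<close>.\<close>
  proof (rule bij_betw_byWitness[where f' = "\<lambda>x. (nat \<lfloor>x b\<rfloor>, restrict x A)"])
    have res: "restrict (x(b := r)) A = x" if "x \<in> A \<rightarrow>\<^sub>E (\<int>::real set)" for x r
      using that \<open>b \<notin> A\<close> by (auto simp: fun_eq_iff PiE_def extensional_def)
    show "\<forall>p\<in>Sigma J F. (\<lambda>x. (nat \<lfloor>x b\<rfloor>, restrict x A)) ((\<lambda>(j, x). x(b := real j)) p) = p"
    proof
      fix p assume "p \<in> Sigma J F"
      then obtain j x where p: "p = (j, x)" "j \<in> J" "x \<in> F j" by blast
      then have "x \<in> A \<rightarrow>\<^sub>E \<int>" using F by blast
      then show "(\<lambda>x. (nat \<lfloor>x b\<rfloor>, restrict x A)) ((\<lambda>(j, x). x(b := real j)) p) = p"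
        by (simp add: p res del: restrict_fun_upd)
    qed
    show "(\<lambda>(j, x). x(b := real j)) ` Sigma J F \<subseteq> S"
    proof clarify
      fix j x assume jx: "j \<in> J" "x \<in> F j"
      then have "x \<in> A \<rightarrow>\<^sub>E \<int>" using F by blast
      then show "x(b := real j) \<in> S"
        using jx res[of x "real j"] \<open>b \<notin> A\<close>
        by (auto simp: S PiE_def extensional_def simp del: restrict_fun_upd)
    qed
    show "\<forall>x\<in>S. (\<lambda>(j, x). x(b := real j)) (nat \<lfloor>x b\<rfloor>, restrict x A) = x"
      by (auto simp: S fun_eq_iff PiE_def extensional_def)
    show "(\<lambda>x. (nat \<lfloor>x b\<rfloor>, restrict x A)) ` S \<subseteq> Sigma J F"
      by (auto simp: S)
  qed
  show "finite S"
    unfolding bij_betw_finite[OF bij, symmetric] using \<open>finite J\<close> fin by (rule finite_SigmaI)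
  show "card S = (\<Sum>j\<in>J. card (F j))"
    unfolding bij_betw_same_card[OF bij, symmetric] using \<open>finite J\<close> fin by (intro card_SigmaI) auto
qed

lemma nonneg_Ints_real: "0 \<le> y \<Longrightarrow> y \<in> \<int> \<Longrightarrow> \<exists>j. y = real j"
  by (auto elim!: Ints_cases nonneg_int_cases)

text \<open>Induction on the index set: the slice at height \<open>j\<close> is a simplex of size
  \<open>m - j\<close> in one dimension less.\<close>

lemma card_lattice_simplex:
  fixes A :: "'a set"
  assumes "finite A"
  shows "finite (lattice_simplex A (real m))"
    and "card (lattice_simplex A (real m)) = (m + card A) choose card A"
proof -
  have "finite (lattice_simplex A (real m)) \<and>
        card (lattice_simplex A (real m)) = (m + card A) choose card A"
    using assms
  proof (induction A arbitrary: m rule: finite_induct)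
    case empty
    have "lattice_simplex ({} :: 'a set) (real m) = {\<lambda>_. undefined}"
      by (auto simp: lattice_simplex_def)
    then show ?case by simp
  next
    case (insert b A)
    let ?F = "\<lambda>j. lattice_simplex A (real (m - j))"
    have S: "x \<in> lattice_simplex (insert b A) (real m) \<longleftrightarrow>
        x \<in> insert b A \<rightarrow>\<^sub>E \<int> \<and> (\<exists>j\<in>{..m}. x b = real j \<and> restrict x A \<in> ?F j)" for x
    proof (intro iffI conjI)
      assume x: "x \<in> lattice_simplex (insert b A) (real m)"
      then show "x \<in> insert b A \<rightarrow>\<^sub>E \<int>" by (simp add: lattice_simplex_def)
      from x obtain j where j: "x b = real j"
        using nonneg_Ints_real[of "x b"] by (force simp: lattice_simplex_def)
      have le: "real j + sum x A \<le> real m" and "sum x A \<ge> 0"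
        using x insert.hyps j by (auto simp: lattice_simplex_def intro: sum_nonneg)
      \<comment> \<open>This bound keeps the natural number \<open>m - j\<close> from being
        truncated.\<close>
      then have "j \<le> m" by linarith
      moreover have "restrict x A \<in> ?F j"
        using x le \<open>j \<le> m\<close> by (auto simp: lattice_simplex_def of_nat_diff PiE_def)
      ultimately show "\<exists>j\<in>{..m}. x b = real j \<and> restrict x A \<in> ?F j"
        using j by auto
    next
      assume "x \<in> insert b A \<rightarrow>\<^sub>E \<int> \<and> (\<exists>j\<in>{..m}. x b = real j \<and> restrict x A \<in> ?F j)"
      then show "x \<in> lattice_simplex (insert b A) (real m)"
        using insert.hyps by (auto simp: lattice_simplex_def of_nat_diff)
    qed
    have fin: "finite (?F j)" and sub: "?F j \<subseteq> A \<rightarrow>\<^sub>E \<int>" for j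
      using insert.IH by (auto simp: lattice_simplex_def)
    note * = card_sliced_lattice[OF insert.hyps(2) finite_atMost fin sub S]
    have "card (lattice_simplex (insert b A) (real m)) = (\<Sum>j\<le>m. (m - j + card A) choose card A)"
      unfolding *(2) using insert.IH by (simp del: of_nat_diff)
    also have "\<dots> = (\<Sum>j\<le>m. (card A + j) choose card A)"
      by (rule sum.reindex_bij_witness[of _ "\<lambda>j. m - j" "\<lambda>j. m - j"]) (auto simp: add.commute)
    \<comment> \<open>The hockey-stick identity.\<close>
    also have "\<dots> = (m + card (insert b A)) choose card (insert b A)"
      using insert.hyps by (simp only: choose_rising_sum(1)) (simp add: add_ac)
    finally show ?case using *(1) by simp
  qed
  then show "finite (lattice_simplex A (real m))"
    and "card (lattice_simplex A (real m)) = (m + card A) choose card A"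
    by auto
qed

lemma finite_lattice_simplex_of_int:
  assumes "finite A"
  shows "finite (lattice_simplex A (real_of_int z))"
proof (cases "z < 0")
  case False
  then show ?thesis
    using card_lattice_simplex(1)[OF assms, of "nat z"] by simp
qed (simp add: lattice_simplex_neg)

text \<open>The count is eventually a binomial coefficient with \<open>card A\<close> linear factors
  in \<open>n\<close> when \<open>i\<close> is positive. Each factor absorbs one \<open>n\<close> of
  the denominator and then tends to \<open>i\<close>.\<close>

lemma card_lattice_simplex_asymp:
  assumes A: "finite A" "A \<noteq> {}"
  shows "(\<lambda>n. real (card (lattice_simplex A (real_of_int (a + int n * int i)))) / real n ^ card A)
           \<longlonglongrightarrow> real i ^ card A / fact (card A)"
proof (cases "i = 0")
  \<comment> \<open>The size stays \<open>a\<close>, so the count is constant in \<open>n\<close>. A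
    positive power of \<open>n\<close> in the denominator sends the quotient to 0.\<close>
  case True
  let ?c = "real (card (lattice_simplex A (real_of_int a)))"
  have "card A > 0" using A by (simp add: card_gt_0_iff)
  moreover have "(\<lambda>n. ?c * (1 / real n) ^ card A) \<longlonglongrightarrow> ?c * 0 ^ card A"
    by (intro tendsto_intros lim_1_over_n)
  ultimately show ?thesis
    using True by (simp add: zero_power power_one_over divide_inverse power_inverse)
next
  case False
  let ?d = "card A"
  have "\<forall>\<^sub>F n in sequentially. n > 0 \<and> n \<ge> nat \<bar>a\<bar>"
    using eventually_gt_at_top[of 0] eventually_ge_at_top[of "nat \<bar>a\<bar>"] by eventually_elim simp
  then have ev: "\<forall>\<^sub>F n in sequentially.
     (\<Prod>k=0..<?d. real i + (real_of_int a + real ?d - real k) / real n) / fact ?d =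
     real (card (lattice_simplex A (real_of_int (a + int n * int i)))) / real n ^ ?d"
  proof eventually_elim
    case (elim n)
    \<comment> \<open>With \<open>i\<close> at least 1 and \<open>n\<close> at least the absolute
      value of \<open>a\<close>, the size is a natural number and the binomial formula
      applies.\<close>
    have "int n * 1 \<le> int n * int i" using False by (intro mult_left_mono) auto
    then have "a + int n * int i \<ge> 0" using elim by linarith
    then obtain m where m: "a + int n * int i = int m" using nonneg_int_cases by blast
    then have m': "real m = real_of_int a + real n * real i"
      by (metis of_int_add of_int_mult of_int_of_nat_eq)
    have "real (card (lattice_simplex A (real_of_int (a + int n * int i)))) = real ((m + ?d) choose ?d)"
      using card_lattice_simplex(2)[OF A(1), of m] m by simp
    also have "\<dots> = (\<Prod>k=0..<?d. real m + real ?d - real k) / fact ?d"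
      by (simp add: binomial_gbinomial gbinomial_prod_rev)
    also have "\<dots> / real n ^ ?d = (\<Prod>k=0..<?d. (real m + real ?d - real k) / real n) / fact ?d"
      by (simp add: prod_dividef)
    also have "\<dots> = (\<Prod>k=0..<?d. real i + (real_of_int a + real ?d - real k) / real n) / fact ?d"
      using elim by (intro arg_cong2[of _ _ _ _ "(/)"] prod.cong refl) (simp add: m' field_simps)
    finally show ?case by simp
  qed
  have "(\<lambda>n. (\<Prod>k=0..<?d. real i + (real_of_int a + real ?d - real k) / real n) / fact ?d)
      \<longlonglongrightarrow> (\<Prod>k=0..<?d. real i + 0) / fact ?d"
    by (intro tendsto_intros lim_const_over_n) auto
  then show ?thesis
    using ev by (simp add: tendsto_cong)
qed

section \<open>Lattice points of the polytope\<close>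

text \<open>The slice at height \<open>j\<close> of the last coordinate has size
  \<open>a + n * (m - j)\<close>, and \<open>i = m - j\<close> measures the distance from the top.
  Cardinalities instead of binomial coefficients cover negative \<open>a\<close>, where some slices
  may be empty.\<close>

lemma hirzebruch_quantization_eq_sum:
  "hirzebruch_quantization d a (int m) n =
     (\<Sum>i\<le>m. card (lattice_simplex {1..d} (real_of_int (a + int n * int i))))"
proof -
  let ?F = "\<lambda>j. lattice_simplex {1..d} (real_of_int (a + int n * int (m - j)))"
  have ins: "{1..d+1} = insert (d+1) {1..d}" by auto
  have S: "x \<in> hirzebruch_polytope d a (int m) n \<inter> ({1..d+1} \<rightarrow>\<^sub>E \<int>) \<longleftrightarrow>
      x \<in> insert (d+1) {1..d} \<rightarrow>\<^sub>E \<int> \<and> (\<exists>j\<in>{..m}. x (d+1) = real j \<and> restrict x {1..d} \<in> ?F j)" for x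
  proof (intro iffI conjI)
    assume x: "x \<in> hirzebruch_polytope d a (int m) n \<inter> ({1..d+1} \<rightarrow>\<^sub>E \<int>)"
    then show "x \<in> insert (d+1) {1..d} \<rightarrow>\<^sub>E \<int>" by (simp only: ins Int_iff)
    then have xd: "x (d+1) \<in> \<int>" by (auto simp: PiE_def)
    with x obtain j where j: "x (d+1) = real j"
      using nonneg_Ints_real[of "x (d+1)"] by (auto simp: hirzebruch_polytope_def)
    have "j \<le> m" using x j by (simp add: hirzebruch_polytope_def)
    moreover have "restrict x {1..d} \<in> ?F j"
      using x j \<open>j \<le> m\<close> by (auto simp: lattice_simplex_def hirzebruch_polytope_def of_nat_diff PiE_def)
    ultimately show "\<exists>j\<in>{..m}. x (d+1) = real j \<and> restrict x {1..d} \<in> ?F j"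
      using j by auto
  next
    assume "x \<in> insert (d+1) {1..d} \<rightarrow>\<^sub>E \<int> \<and> (\<exists>j\<in>{..m}. x (d+1) = real j \<and> restrict x {1..d} \<in> ?F j)"
    then show "x \<in> hirzebruch_polytope d a (int m) n \<inter> ({1..d+1} \<rightarrow>\<^sub>E \<int>)"
      unfolding hirzebruch_polytope_def ins
      by (auto simp: lattice_simplex_def of_nat_diff PiE_def)
  qed
  have "hirzebruch_quantization d a (int m) n = (\<Sum>j\<le>m. card (?F j))"
    unfolding hirzebruch_quantization_def
  proof (rule card_sliced_lattice(2)[OF _ finite_atMost _ _ S])
    show "?F j \<subseteq> {1..d} \<rightarrow>\<^sub>E \<int>" for j
      by (auto simp: lattice_simplex_def)
  qed (simp_all add: finite_lattice_simplex_of_int del: of_int_add)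
  also have "\<dots> = (\<Sum>i\<le>m. card (lattice_simplex {1..d} (real_of_int (a + int n * int i))))"
    by (rule sum.reindex_bij_witness[of _ "\<lambda>j. m - j" "\<lambda>j. m - j"]) auto
  finally show ?thesis .
qed

lemma hirzebruch_quantization_asymp:
  assumes "d \<ge> 1"
  shows "(\<lambda>n. real (hirzebruch_quantization d a (int m) n) / real n ^ d)
           \<longlonglongrightarrow> (\<Sum>i=1..m. real i ^ d) / fact d"
proof -
  have "(\<lambda>n. \<Sum>i\<le>m. real (card (lattice_simplex {1..d} (real_of_int (a + int n * int i)))) / real n ^ d)
      \<longlonglongrightarrow> (\<Sum>i\<le>m. real i ^ d / fact d)"
    using card_lattice_simplex_asymp[of "{1..d}" a] assms by (intro tendsto_sum) simp
  \<comment> \<open>The term \<open>i = 0\<close> vanishes because \<open>d\<close> is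
    positive.\<close>
  moreover have "(\<Sum>i\<le>m. real i ^ d / fact d) = (\<Sum>i=1..m. real i ^ d) / fact d"
    using assms by (subst sum_divide_distrib) (intro sum.mono_neutral_right, auto simp: not_le)
  ultimately show ?thesis
    by (simp add: hirzebruch_quantization_eq_sum sum_divide_distrib del: of_int_add)
qed

section \<open>Volume of the polytope\<close>

lemma emeasure_simplex_PiM:
  assumes "finite A"
  shows "emeasure (\<Pi>\<^sub>M i\<in>A. lborel) {x \<in> A \<rightarrow>\<^sub>E UNIV. (\<forall>i\<in>A. 0 \<le> x i) \<and> sum x A \<le> t} =
           (if t < 0 then 0 else ennreal (t ^ card A / fact (card A)))"
proof (cases "t < 0")
  case True
  then have "{x \<in> A \<rightarrow>\<^sub>E UNIV. (\<forall>i\<in>A. 0 \<le> x i) \<and> sum x A \<le> t} = {}"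
    using sum_nonneg[of A] by fastforce
  then show ?thesis by (simp only: True if_True emeasure_empty)
next
  case False
  have "{x \<in> A \<rightarrow>\<^sub>E UNIV. (\<forall>i\<in>A. 0 \<le> x i) \<and> sum x A \<le> t} =
        {x. (\<forall>i\<in>A. 0 \<le> x i) \<and> sum x A \<le> t} \<inter> space (\<Pi>\<^sub>M i\<in>A. lborel)"
    by (auto simp: space_PiM)
  then show ?thesis
    using emeasure_std_simplex_aux[OF assms, of t] False by simp
qed

lemma hirzebruch_polytope_measurable:
  "hirzebruch_polytope d a b n \<in> sets (\<Pi>\<^sub>M i\<in>{1..d+1}. lborel)"
proof -
  let ?M = "\<Pi>\<^sub>M i\<in>{1..d+1}. lborel :: real measure"
  have comp: "(\<lambda>x. x i) \<in> borel_measurable ?M" if "i \<in> {1..d+1}" for i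
    using that measurable_component_singleton[of i "{1..d+1}" "\<lambda>_. lborel :: real measure"] by simp
  have "hirzebruch_polytope d a b n =
      (\<Inter>i\<in>{1..d+1}. {x \<in> space ?M. 0 \<le> x i}) \<inter>
      {x \<in> space ?M. (\<Sum>i=1..d. x i) \<le> real_of_int a + real n * (real_of_int b - x (d+1))} \<inter>
      {x \<in> space ?M. x (d+1) \<le> real_of_int b}"
    by (auto simp: hirzebruch_polytope_def space_PiM)
  also have "\<dots> \<in> sets ?M"
    by (intro sets.Int sets.finite_INT borel_measurable_le borel_measurable_const comp
          borel_measurable_add borel_measurable_times borel_measurable_diff borel_measurable_sum) auto
  finally show ?thesis .
qed

text \<open>Integrate the volumes of the slices over the last coordinate. For
  \<open>a \<ge> 0\<close> this is the usual formula. For negative \<open>a\<close> the slices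
  shrink to a point at height b + a/n, below b, so the lower boundary term is 0 instead of
  a^(d+1).\<close>

lemma hirzebruch_volume_eq:
  assumes "b \<ge> 1" "n > 0" "int n \<ge> - a"
  shows "hirzebruch_volume d a b n =
     ((real_of_int a + real n * real_of_int b) ^ (d + 1) - max 0 (real_of_int a) ^ (d + 1))
       / (fact (d + 1) * real n)"
proof -
  let ?M = "\<lambda>A. \<Pi>\<^sub>M i\<in>A. lborel :: real measure"
  let ?P = "hirzebruch_polytope d a b n"
  let ?S = "\<lambda>t. {x \<in> {1..d} \<rightarrow>\<^sub>E UNIV. (\<forall>i\<in>{1..d}. 0 \<le> x i) \<and> sum x {1..d} \<le> t}"
  define \<alpha> \<beta> \<nu> where "\<alpha> = real_of_int a" and "\<beta> = real_of_int b" and "\<nu> = real n"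
  \<comment> \<open>The height of the polytope: slices end at \<open>\<beta>\<close> or where their
    size reaches 0, whichever comes first.\<close>
  define c where "c = min \<beta> (\<beta> + \<alpha> / \<nu>)"
  have pos: "\<nu> > 0" "\<beta> \<ge> 1" using assms by (auto simp: \<nu>_def \<beta>_def)
  have "\<nu> * 1 \<le> \<nu> * \<beta>" using pos by (intro mult_left_mono) auto
  moreover have "- \<alpha> \<le> \<nu>" using assms(3) by (simp add: \<alpha>_def \<nu>_def)
  ultimately have nonneg: "0 \<le> \<alpha> + \<nu> * \<beta>" by linarith
  have c: "0 \<le> c" using pos nonneg by (simp add: c_def field_simps)
  have end_c: "\<alpha> + \<nu> * (\<beta> - c) = max 0 \<alpha>"
    using pos by (simp add: c_def min_def max_def field_simps)
  have "\<beta> + \<alpha> / \<nu> - y = (\<alpha> + \<nu> * (\<beta> - y)) / \<nu>" for y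
    using pos by (simp add: field_simps)
  then have "0 \<le> \<alpha> + \<nu> * (\<beta> - y) \<longleftrightarrow> y \<le> \<beta> + \<alpha> / \<nu>" for y
    using pos by (metis diff_ge_0_iff_ge zero_le_divide_iff not_less order.strict_implies_order)
  then have in_c: "y \<le> \<beta> \<and> 0 \<le> \<alpha> + \<nu> * (\<beta> - y) \<longleftrightarrow> y \<le> c" for y
    by (simp add: c_def)
  interpret product_sigma_finite "\<lambda>_. lborel :: real measure"
    by standard
  have ins: "{1..d+1} = insert (d+1) {1..d}" by auto
  have meas: "?P \<in> sets (?M (insert (d+1) {1..d}))"
    using hirzebruch_polytope_measurable[of d a b n] by (simp only: ins)
  have slice: "x(d+1 := y) \<in> ?P \<longleftrightarrow> y \<in> {0..\<beta>} \<and> x \<in> ?S (\<alpha> + \<nu> * (\<beta> - y))"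
    if "x \<in> space (?M {1..d})" for x y
  proof -
    have "x(d+1 := y) \<in> insert (d+1) {1..d} \<rightarrow>\<^sub>E UNIV" "x \<in> {1..d} \<rightarrow>\<^sub>E UNIV"
      using that by (auto simp: space_PiM PiE_def extensional_def)
    moreover have "sum (x(d+1 := y)) {1..d} = sum x {1..d}"
      by (intro sum.cong) auto
    moreover have "(\<forall>i\<in>insert (d+1) {1..d}. 0 \<le> (x(d+1 := y)) i) \<longleftrightarrow> 0 \<le> y \<and> (\<forall>i\<in>{1..d}. 0 \<le> x i)"
      by auto
    ultimately show ?thesis
      unfolding hirzebruch_polytope_def ins by (auto simp: \<alpha>_def \<beta>_def \<nu>_def)
  qed
  have S_meas: "?S t \<in> sets (?M {1..d})" for t
  proof -
    have "?S t = {x \<in> space (?M {1..d}). (\<forall>i\<in>{1..d}. 0 \<le> x i) \<and> sum x {1..d} \<le> t}"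
      by (auto simp: space_PiM)
    also have "\<dots> \<in> sets (?M {1..d})" by measurable
    finally show ?thesis .
  qed
  have "emeasure (?M {1..d+1}) ?P = (\<integral>\<^sup>+ x. indicator ?P x \<partial>?M (insert (d+1) {1..d}))"
    unfolding ins using meas by (subst nn_integral_indicator) auto
  \<comment> \<open>Fubini, with the last coordinate outermost.\<close>
  also have "\<dots> = (\<integral>\<^sup>+ y. \<integral>\<^sup>+ x. indicator ?P (x(d+1 := y)) \<partial>?M {1..d} \<partial>lborel)"
    using meas by (intro product_nn_integral_insert_rev) auto
  also have "\<dots> = (\<integral>\<^sup>+ y. \<integral>\<^sup>+ x. indicator {0..\<beta>} y * indicator (?S (\<alpha> + \<nu> * (\<beta> - y))) x
                    \<partial>?M {1..d} \<partial>lborel)"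
    by (intro nn_integral_cong) (simp only: indicator_def slice, simp)
  also have "\<dots> = (\<integral>\<^sup>+ y. indicator {0..\<beta>} y * emeasure (?M {1..d}) (?S (\<alpha> + \<nu> * (\<beta> - y))) \<partial>lborel)"
    using S_meas by (subst nn_integral_cmult) auto
  \<comment> \<open>Slices between \<open>c\<close> and \<open>\<beta>\<close> have negative size
    and measure 0. Cutting the range at \<open>c\<close> leaves a polynomial integrand that is
    nonnegative there.\<close>
  also have "\<dots> = (\<integral>\<^sup>+ y\<in>{0..c}. ennreal ((\<alpha> + \<nu> * (\<beta> - y)) ^ d / fact d) \<partial>lborel)"
    unfolding emeasure_simplex_PiM[OF finite_atLeastAtMost]
  proof (rule nn_integral_cong)
    fix y
    show "indicator {0..\<beta>} y * (if \<alpha> + \<nu> * (\<beta> - y) < 0 then 0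
        else ennreal ((\<alpha> + \<nu> * (\<beta> - y)) ^ card {1..d} / fact (card {1..d}))) =
      ennreal ((\<alpha> + \<nu> * (\<beta> - y)) ^ d / fact d) * indicator {0..c} y"
      using in_c[of y] by (auto simp: indicator_def)
  qed
  also have "\<dots> = ennreal ((- 1 / (fact (d + 1) * \<nu>) * (\<alpha> + \<nu> * (\<beta> - c)) ^ Suc d) -
                          (- 1 / (fact (d + 1) * \<nu>) * (\<alpha> + \<nu> * (\<beta> - 0)) ^ Suc d))"
  proof (rule nn_integral_FTC_Icc)
    show "((\<lambda>y. (- 1 / (fact (d + 1) * \<nu>) * (\<alpha> + \<nu> * (\<beta> - y)) ^ Suc d)) has_real_derivative
        (\<alpha> + \<nu> * (\<beta> - y)) ^ d / fact d) (at y)" if "y \<in> {0..c}" for y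
    proof -
      have "((\<lambda>y. (\<alpha> + \<nu> * (\<beta> - y)) ^ Suc d) has_real_derivative
          real (Suc d) * (\<alpha> + \<nu> * (\<beta> - y)) ^ d * (- \<nu>)) (at y)"
        by (rule derivative_eq_intros refl | simp)+
      moreover have "- 1 / (fact (d + 1) * \<nu>) * (real (Suc d) * z * (- \<nu>)) = z / fact d" for z
        using pos by (simp add: divide_simps)
      ultimately show ?thesis
        by (metis DERIV_cmult)
    qed
    show "0 \<le> (\<alpha> + \<nu> * (\<beta> - y)) ^ d / fact d" if "y \<in> {0..c}" for y
      using in_c[of y] that by simp
  qed (use c in auto)
  also have "(- 1 / (fact (d + 1) * \<nu>) * (\<alpha> + \<nu> * (\<beta> - c)) ^ Suc d) -
                          (- 1 / (fact (d + 1) * \<nu>) * (\<alpha> + \<nu> * (\<beta> - 0)) ^ Suc d) =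
       ((\<alpha> + \<nu> * \<beta>) ^ (d + 1) - max 0 \<alpha> ^ (d + 1)) / (fact (d + 1) * \<nu>)"
    unfolding end_c by (simp add: diff_divide_distrib)
  finally have "hirzebruch_volume d a b n =
       enn2real (ennreal (((\<alpha> + \<nu> * \<beta>) ^ (d + 1) - max 0 \<alpha> ^ (d + 1)) / (fact (d + 1) * \<nu>)))"
    by (simp only: hirzebruch_volume_def measure_def)
  \<comment> \<open>This makes the real value nonnegative, so that \<open>enn2real\<close> undoes
    \<open>ennreal\<close>.\<close>
  moreover have "max 0 \<alpha> \<le> \<alpha> + \<nu> * \<beta>"
    using nonneg pos by simp
  then have "max 0 \<alpha> ^ (d + 1) \<le> (\<alpha> + \<nu> * \<beta>) ^ (d + 1)"
    by (intro power_mono) auto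
  ultimately show ?thesis
    using pos by (simp add: \<alpha>_def \<beta>_def \<nu>_def)
qed

text \<open>Of the n^(d+1) in the denominator, n^d comes from the scaling and one \<open>n\<close>
  from the exact formula. Inside the powers, \<open>a\<close> occurs only divided by
  \<open>n\<close>, so it disappears from the limit.\<close>

lemma hirzebruch_volume_asymp:
  assumes "b \<ge> 1"
  shows "(\<lambda>n. hirzebruch_volume d a b n / real n ^ d) \<longlonglongrightarrow> real_of_int b ^ (d + 1) / fact (d + 1)"
proof -
  let ?f = "\<lambda>n. ((real_of_int b + real_of_int a / real n) ^ (d + 1) -
                 (max 0 (real_of_int a) / real n) ^ (d + 1)) / fact (d + 1)"
  have "?f \<longlonglongrightarrow> ((real_of_int b + 0) ^ (d + 1) - 0 ^ (d + 1)) / fact (d + 1)"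
    by (intro tendsto_intros lim_const_over_n) auto
  moreover have "\<forall>\<^sub>F n in sequentially. ?f n = hirzebruch_volume d a b n / real n ^ d"
    using eventually_gt_at_top[of 0] eventually_ge_at_top[of "nat \<bar>a\<bar>"]
  proof eventually_elim
    case (elim n)
    have "real_of_int b + real_of_int a / real n = (real_of_int a + real n * real_of_int b) / real n"
      using elim by (simp add: field_simps)
    then have "?f n = ((real_of_int a + real n * real_of_int b) ^ (d + 1) -
        max 0 (real_of_int a) ^ (d + 1)) / real n ^ (d + 1) / fact (d + 1)"
      by (simp only: power_divide diff_divide_distrib)
    moreover have "int n \<ge> - a" using elim by linarith
    ultimately show ?case
      using elim assms by (simp add: hirzebruch_volume_eq mult_ac)
  qed
  ultimately show ?thesis
    by (simp add: tendsto_cong)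
qed

section \<open>The limit of the quotient and its polynomial form\<close>

text \<open>The sign (-1)^k comes from Faulhaber's formula with the upper end included: for d = b =
  1 and a = 0 there are n + 2 lattice points and the volume is n/2, so the limit is 2 = 1 + 2 *
  (1/2). For \<open>b \<le> 0\<close> the volume is 0. Choosing \<open>p\<close> before
  \<open>a\<close> and \<open>b\<close> expresses the independence of \<open>a\<close>.\<close>

theorem proposition5:
  fixes d :: nat
  assumes "d \<ge> 1"
  shows "(\<forall>a b :: int. b \<ge> 1 \<longrightarrow>
            (\<lambda>n. real (hirzebruch_quantization d a b n) / hirzebruch_volume d a b n)
              \<longlonglongrightarrow> (\<Sum>k=0..d. real ((d + 1) choose k) * ((-1) ^ k * bernoulli k)
                                * real_of_int b powi (- int k))) \<and>
         (\<exists>p :: real poly. degree p \<le> d + 1 \<and>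
            (\<forall>a b :: int. b \<ge> 1 \<longrightarrow>
               poly p (1 / real_of_int b) =
                 (\<Sum>k=0..d. real ((d + 1) choose k) * ((-1) ^ k * bernoulli k)
                              * real_of_int b powi (- int k)) \<and>
               asymp_equiv (\<lambda>n. real (hirzebruch_quantization d a b n)) sequentially
                 (\<lambda>n. poly p (1 / real_of_int b) * hirzebruch_volume d a b n)))"
proof -
  define L where "L b = (\<Sum>k=0..d. real ((d + 1) choose k) * ((-1) ^ k * bernoulli k)
                              * real_of_int b powi (- int k))" for b
  define p where "p = (\<Sum>k=0..d. monom (real ((d + 1) choose k) * ((-1) ^ k * bernoulli k)) k)"
  \<comment> \<open>Faulhaber's formula divided by b^(d+1).\<close>
  have L: "L b = real (d + 1) * (\<Sum>i=1..nat b. real i ^ d) / real_of_int b ^ (d + 1)"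
    if "b \<ge> 1" for b
    unfolding sum_power_eq_bernoulli L_def sum_divide_distrib
    using that by (intro sum.cong refl) (simp add: power_int_minus power_diff field_simps)
  \<comment> \<open>A nonzero limit is what turns convergence of the quotient into asymptotic
    equivalence.\<close>
  have L_pos: "L b > 0" if "b \<ge> 1" for b
    unfolding L[OF that] using that
    by (intro divide_pos_pos mult_pos_pos sum_pos zero_less_power) auto
  have lim: "(\<lambda>n. real (hirzebruch_quantization d a b n) / hirzebruch_volume d a b n) \<longlonglongrightarrow> L b"
    if b: "b \<ge> 1" for a b
  proof -
    have "(\<lambda>n. (real (hirzebruch_quantization d a b n) / real n ^ d) /
               (hirzebruch_volume d a b n / real n ^ d))
        \<longlonglongrightarrow> ((\<Sum>i=1..nat b. real i ^ d) / fact d) / (real_of_int b ^ (d + 1) / fact (d + 1))"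
    proof (intro tendsto_divide[OF _ hirzebruch_volume_asymp[OF b]])
      show "(\<lambda>n. real (hirzebruch_quantization d a b n) / real n ^ d)
          \<longlonglongrightarrow> (\<Sum>i=1..nat b. real i ^ d) / fact d"
        using b hirzebruch_quantization_asymp[OF assms, of a "nat b"] by simp
    qed (use b in simp)
    then have "(\<lambda>n. real (hirzebruch_quantization d a b n) / hirzebruch_volume d a b n)
        \<longlonglongrightarrow> ((\<Sum>i=1..nat b. real i ^ d) / fact d) / (real_of_int b ^ (d + 1) / fact (d + 1))"
    proof (rule Lim_transform_eventually)
      show "\<forall>\<^sub>F n in sequentially.
        (real (hirzebruch_quantization d a b n) / real n ^ d) /
               (hirzebruch_volume d a b n / real n ^ d) =
        real (hirzebruch_quantization d a b n) / hirzebruch_volume d a b n"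
        using eventually_gt_at_top[of 0] by eventually_elim simp
    qed
    \<comment> \<open>The quotient of the factorials supplies the factor d + 1 of Faulhaber's
      formula.\<close>
    moreover have "((\<Sum>i=1..nat b. real i ^ d) / fact d) / (real_of_int b ^ (d + 1) / fact (d + 1)) = L b"
      unfolding L[OF b] using b by (simp add: divide_simps)
    ultimately show ?thesis
      by (simp only:)
  qed
  have "degree p \<le> d + 1"
    unfolding p_def by (intro degree_sum_le) (auto intro: order.trans[OF degree_monom_le])
  moreover have "poly p (1 / real_of_int b) = L b" for b
    by (simp add: p_def L_def poly_sum poly_monom power_int_minus power_one_over field_simps)
  moreover have "(\<lambda>n. real (hirzebruch_quantization d a b n)) \<sim>[sequentially]
      (\<lambda>n. L b * hirzebruch_volume d a b n)" if "b \<ge> 1" for a b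
    using lim[OF that] L_pos[OF that] by (intro asymp_equivI'_const) auto
  ultimately show ?thesis
    using lim unfolding L_def[symmetric] by (intro conjI exI[of _ p]) auto
qed

end
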